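(* Let $F$ be a clause-set with all clauses of length $1$ or $2$, and let $\{x\}\in F$. For $P \in \mathfrak U_x(\mathrm{idg}(F))$ let $F(P) := \mathcal{CL}(E(P)) \cup \{\{x\}\}\subseteq F$. Then: 1. The map $P\mapsto F(P)$ is a surjection from $\mathfrak U_x(\mathrm{idg}(F))$ onto the set $\mathrm{mus}_{\{x\}}(F)$ of minimally unsatisfiable subsets of $F$ containing $\{x\}$. 2. For $F'\in \mathrm{mus}_{\{x\}}(F)$, the preimage $\{P \in \mathfrak U_x(\mathrm{idg}(F)) : F(P)=F'\}$ has exactly one element iff $F'$ contains exactly two unit-clauses (i.e. belongs to Family I). These $F'$ are exactly the $F(P)$ for those $P\in\mathfrak U_x(\mathrm{idg}(F))$ whose final arc is a unit; removing that final arc, which corresponds to the second unit-clause $\{y\}$ of $F'$, yields a regular path from $x$ to $\overline y$. 3. For every $F'\in\mathrm{mus}_{\{x\}}(F)$ containing exactly one unit-clause (namely $\{x\}$) the preimage has exactly two elements; more precisely, let $P\in\mathfrak U_x(\mathrm{idg}(F))$ with $F(P)=F'$: (a) If the last vertex of $P$ is $\overline x$, then $P$ has length at least $2$, $F'$ belongs to Family IIa, $\overline P \neq P$, $\overline P\in\mathfrak U_x(\mathrm{idg}(F))$, $F(\overline P)=F(P)$, and the preimage of $F'$ is $\{P,\overline P\}$. (b) Otherwise $F'$ belongs to Family IIb; with the regular decomposition $P=P_0;P_1$ and $P' := P_0;\overline{P_1}$ we have $P'\ne P$ and the preimage of $F'$ is $\{P,P'\}$.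
   Context: Literals are variables and complements ($\overline{\overline x}=x$); clauses are finite sets of literals without complementary pair; clause-sets are finite sets of clauses. A clause-set is minimally unsatisfiable (MU) if unsatisfiable and removing any one clause makes it satisfiable. $\mathrm{vdeg}_F(v)$ is the number of clauses containing $v$ or $\overline v$. The implication digraph $\mathrm{idg}(F)$ has vertex set all literals whose variable occurs in $F$; each binary clause $\{a,b\}$ yields arcs $(\overline a,b),(\overline b,a)$, and each unit-clause $\{a\}$ yields the arc $(\overline a,a)$; an arc of the form $(a,\overline a)$ is called a unit. For an arc set $A$, $\mathcal{CL}(A)=\{\{\overline a,b\}:(a,b)\in A\}$. Paths have pairwise distinct vertices; a path is regular if its vertex set has no complementary pair. A path is nearly regular if its vertex set contains exactly one complementary pair and the path without its last vertex is regular; $\mathfrak U_x(\mathrm{idg}(F))$ is the set of nearly regular paths starting at $x$. For a nearly regular path $P$ with last vertex $w$, the vertex $\overline w$ occurs on $P$; the regular decomposition $P=P_0;P_1$ splits $P$ at $\overline w$, where $P_0$ is the initial segment ending at $\overline w$ and $P_1$ the segment from $\overline w$ to $w$ (if $\overline w = x$, $P_0$ is trivial and $P_1=P$). For a path $Q$ of length $\ge1$, its contraposition $\overline Q$ replaces each arc $(a,b)$ by $(\overline b,\overline a)$ and reverses the order (a path from the complement of the last vertex of $Q$ to the complement of its first vertex). Family I: MU clause-sets with clauses of length $\le2$ containing exactly two unit-clauses. Family II: those containing exactly one unit-clause $\{z\}$; within it, Family IIa consists of those whose unique variable of degree $\mathrm{vdeg}=3$ is the variable of $z$ (shape: $\{z\}$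 plus an implication chain $z\to\dots\to\overline z$), and Family IIb of the others (shape: $\{z\}$ plus an implication chain $z\to\dots\to y\to\dots\to\overline y$ with $\mathrm{var}(y)\ne\mathrm{var}(z)$ the unique degree-3 variable). *)

theory Defs
  imports Graph_Theory.Vertex_Walk Graph_Theory.Pair_Digraph
begin

section \<open>Clause-sets\<close>

datatype 'v lit = Pos 'v | Neg 'v

fun var :: "'v lit \<Rightarrow> 'v" where
  "var (Pos v) = v"
| "var (Neg v) = v"

fun compl :: "'v lit \<Rightarrow> 'v lit" where
  "compl (Pos v) = Neg v"
| "compl (Neg v) = Pos v"

lemma compl_compl [simp]: "compl (compl a) = a"
  by (cases a) simp_all

type_synonym 'v clause = "'v lit set"

definition complementary_pairs :: "'v lit set \<Rightarrow> 'v lit set set" where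
  "complementary_pairs S = {{a, compl a} | a. a \<in> S \<and> compl a \<in> S}"

definition clause :: "'v clause \<Rightarrow> bool" where
  "clause C \<longleftrightarrow> finite C \<and> complementary_pairs C = {}"

definition clause_set :: "'v clause set \<Rightarrow> bool" where
  "clause_set F \<longleftrightarrow> finite F \<and> (\<forall>C\<in>F. clause C)"

fun lit_true :: "('v \<Rightarrow> bool) \<Rightarrow> 'v lit \<Rightarrow> bool" where
  "lit_true \<phi> (Pos v) \<longleftrightarrow> \<phi> v"
| "lit_true \<phi> (Neg v) \<longleftrightarrow> \<not> \<phi> v"

definition satisfiable :: "'v clause set \<Rightarrow> bool" where
  "satisfiable F \<longleftrightarrow> (\<exists>\<phi>. \<forall>C\<in>F. \<exists>a\<in>C. lit_true \<phi> a)"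

definition minimally_unsat :: "'v clause set \<Rightarrow> bool" where
  "minimally_unsat F \<longleftrightarrow>
     clause_set F \<and> \<not> satisfiable F \<and> (\<forall>C\<in>F. satisfiable (F - {C}))"

text \<open>The set \<open>mus\<^bsub>C\<^esub>(F)\<close> of minimally unsatisfiable subsets of \<open>F\<close> containing \<open>C\<close>.\<close>

definition mus :: "'v clause \<Rightarrow> 'v clause set \<Rightarrow> 'v clause set set" where
  "mus C F = {F'. F' \<subseteq> F \<and> C \<in> F' \<and> minimally_unsat F'}"

definition unit_clauses :: "'v clause set \<Rightarrow> 'v clause set" where
  "unit_clauses F = {C \<in> F. card C = 1}"

definition vdeg :: "'v clause set \<Rightarrow> 'v \<Rightarrow> nat" where
  "vdeg F v = card {C \<in> F. Pos v \<in> C \<or> Neg v \<in> C}"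

definition minimally_unsat_2cnf :: "'v clause set \<Rightarrow> bool" where
  "minimally_unsat_2cnf F \<longleftrightarrow> minimally_unsat F \<and> (\<forall>C\<in>F. card C \<le> 2)"

definition family_I :: "'v clause set \<Rightarrow> bool" where
  "family_I F \<longleftrightarrow> minimally_unsat_2cnf F \<and> card (unit_clauses F) = 2"

definition family_II :: "'v clause set \<Rightarrow> bool" where
  "family_II F \<longleftrightarrow> minimally_unsat_2cnf F \<and> card (unit_clauses F) = 1"

definition family_IIa :: "'v clause set \<Rightarrow> bool" where
  "family_IIa F \<longleftrightarrow> family_II F \<and>
     (\<exists>z. unit_clauses F = {{z}} \<and> {v. vdeg F v = 3} = {var z})"

text \<open>
  The definition below asks for a unique variable of degree 3 that differs from \<open>var z\<close>;
  in particular it excludes \<open>family_IIa\<close>.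
\<close>

definition family_IIb :: "'v clause set \<Rightarrow> bool" where
  "family_IIb F \<longleftrightarrow> family_II F \<and>
     (\<exists>z y. unit_clauses F = {{z}} \<and> {v. vdeg F v = 3} = {var y} \<and> var y \<noteq> var z)"


section \<open>The implication digraph and its paths\<close>

text \<open>
  Since \<open>{a, b} = {b, a}\<close>, a binary clause contributes both \<open>(compl a, b)\<close> and \<open>(compl b, a)\<close>.
\<close>

definition idg :: "'v clause set \<Rightarrow> ('v lit, 'v lit \<times> 'v lit) pre_digraph" where
  "idg F = with_proj
     \<lparr> pverts = {a. var a \<in> var ` \<Union>F},
       parcs = {(compl a, b) | a b. a \<noteq> b \<and> {a, b} \<in> F} \<union> {(compl a, a) | a. {a} \<in> F} \<rparr>"

definition unit_arc :: "'v lit \<times> 'v lit \<Rightarrow> bool" where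
  "unit_arc e \<longleftrightarrow> snd e = compl (fst e)"

definition CL :: "('v lit \<times> 'v lit) set \<Rightarrow> 'v clause set" where
  "CL A = {{compl a, b} | a b. (a, b) \<in> A}"

text \<open>
  Paths are given by their vertex sequences (\<^const>\<open>vpath\<close>), with arcs \<^const>\<open>vwalk_arcs\<close>;
  the number of arcs is \<^const>\<open>vwalk_length\<close>, and the composition \<open>P;Q\<close>, which identifies the
  last vertex of \<open>P\<close> with the first vertex of \<open>Q\<close>, is \<^const>\<open>vwalk_join\<close>.
\<close>

definition regular :: "'v lit vwalk \<Rightarrow> bool" where
  "regular p \<longleftrightarrow> complementary_pairs (set p) = {}"

definition nearly_regular :: "'v lit vwalk \<Rightarrow> bool" where
  "nearly_regular p \<longleftrightarrow> card (complementary_pairs (set p)) = 1 \<and> regular (butlast p)"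

text \<open>The set \<open>\<UU>\<^bsub>x\<^esub>(G)\<close>.\<close>

definition nearly_regular_paths ::
    "'v lit \<Rightarrow> ('v lit, 'b) pre_digraph \<Rightarrow> 'v lit vwalk set" where
  "nearly_regular_paths x G = {p. vpath p G \<and> nearly_regular p \<and> hd p = x}"

text \<open>
  The parts \<open>P\<^sub>0\<close> and \<open>P\<^sub>1\<close> of the regular decomposition: the path is split at the
  complement of its last vertex, which belongs to both parts.
\<close>

definition regular_part0 :: "'v lit vwalk \<Rightarrow> 'v lit vwalk" where
  "regular_part0 p = takeWhile (\<lambda>a. a \<noteq> compl (last p)) p @ [compl (last p)]"

definition regular_part1 :: "'v lit vwalk \<Rightarrow> 'v lit vwalk" where
  "regular_part1 p = dropWhile (\<lambda>a. a \<noteq> compl (last p)) p"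

lemma regular_decomposition:
  assumes "compl (last p) \<in> set p"
  shows "vwalk_join (regular_part0 p) (regular_part1 p) = p"
proof -
  have ne: "regular_part1 p \<noteq> []"
    using assms by (auto simp: regular_part1_def dropWhile_eq_Nil_conv)
  then have "hd (regular_part1 p) = compl (last p)"
    unfolding regular_part1_def using hd_dropWhile by blast
  with ne have "regular_part1 p = compl (last p) # tl (regular_part1 p)"
    by (metis list.collapse)
  then have "vwalk_join (regular_part0 p) (regular_part1 p)
      = takeWhile (\<lambda>a. a \<noteq> compl (last p)) p @ regular_part1 p"
    by (simp add: vwalk_join_def regular_part0_def)
  then show ?thesis
    by (simp add: regular_part1_def)
qed

definition contraposition :: "'v lit vwalk \<Rightarrow> 'v lit vwalk" where
  "contraposition p = rev (map compl p)"

lemma vwalk_arcs_contraposition: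
  "vwalk_arcs (contraposition p) = rev (map (\<lambda>(a, b). (compl b, compl a)) (vwalk_arcs p))"
proof (induction p rule: vwalk_arcs.induct)
  case (3 a b p)
  then show ?case
    by (simp add: contraposition_def vwalk_arcs_append last_rev hd_rev
        flip: append_assoc)
qed (simp_all add: contraposition_def)

text \<open>The clause-set \<open>F(P)\<close>; it depends on \<open>F\<close> only through \<open>P\<close> being a path in \<open>idg F\<close>.\<close>

definition path_clauses :: "'v lit \<Rightarrow> 'v lit vwalk \<Rightarrow> 'v clause set" where
  "path_clauses x p = CL (set (vwalk_arcs p)) \<union> {{x}}"

definition path_preimage ::
    "'v clause set \<Rightarrow> 'v lit \<Rightarrow> 'v clause set \<Rightarrow> 'v lit vwalk set" where
  "path_preimage F x F' = {P \<in> nearly_regular_paths x (idg F). path_clauses x P = F'}"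

end

theory Submission
  imports Defs
begin

text \<open>
  A nearly regular path \<open>p\<^sub>0, \<dots>, p\<^sub>n\<close> from \<open>x\<close> is a lasso: \<open>p\<^sub>0, \<dots>, p\<^bsub>n-1\<^esub>\<close> have distinct variables
  and \<open>p\<^sub>n\<close> is the complement of some \<open>p\<^sub>k\<close>. Its \<open>n + 1\<close> clauses \<open>{x}\<close> and \<open>{compl p\<^bsub>i-1\<^esub>, p\<^sub>i}\<close> are
  pairwise distinct, and since every literal lies in hardly any of them, a path through these
  clauses has no choice except for the direction in which it runs around the loop at \<open>p\<^sub>k\<close>. The
  loop has length 1, so that both directions coincide, iff the last arc is a unit.
  Conversely, in a minimally unsatisfiable clause-set containing \<open>{x}\<close> the literal \<open>compl x\<close> is
  reachable from \<open>x\<close>, and the shortest non-regular prefix of a path to it is a lasso.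
\<close>

section \<open>Literals, complements and regularity\<close>

lemma var_compl [simp]: "var (compl a) = var a"
  by (cases a) auto

lemma compl_neq [simp]: "compl a \<noteq> a" "a \<noteq> compl a"
  by (cases a; simp)+

lemma compl_eq_iff [simp]: "compl a = compl b \<longleftrightarrow> a = b"
  by (metis compl_compl)

lemma var_eq_iff: "var a = var b \<longleftrightarrow> a = b \<or> a = compl b"
  by (cases a; cases b) auto

lemma lit_true_compl [simp]: "lit_true \<phi> (compl a) \<longleftrightarrow> \<not> lit_true \<phi> a"
  by (cases a) auto

lemma regular_iff: "regular p \<longleftrightarrow> (\<forall>a\<in>set p. compl a \<notin> set p)"
  by (auto simp: regular_def complementary_pairs_def)

lemma mem_vars_iff: "Pos v \<in> C \<or> Neg v \<in> C \<longleftrightarrow> (\<exists>a\<in>C. var a = v)"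
  by (metis var.simps lit.exhaust)

lemma vdeg_var: "vdeg F (var a) = card {C \<in> F. a \<in> C \<or> compl a \<in> C}"
proof -
  have "Pos (var a) \<in> C \<or> Neg (var a) \<in> C \<longleftrightarrow> a \<in> C \<or> compl a \<in> C" for C
    by (cases a) auto
  then show ?thesis
    by (simp add: vdeg_def)
qed

section \<open>Arcs and walks of the implication digraph\<close>

lemma verts_idg: "verts (idg F) = {a. var a \<in> var ` \<Union>F}"
  by (simp add: idg_def)

text \<open>A unit-clause \<open>{a}\<close> is the degenerate binary clause
  \<open>{compl (compl a), a}\<close>, so a single formula covers both kinds of arcs.\<close>

lemma arcs_ends_idg: "arcs_ends (idg F) = {(a, b). {compl a, b} \<in> F}"
proof -
  have "parcs \<lparr>pverts = V, parcs = {(compl a, b) | a b. a \<noteq> b \<and> {a, b} \<in> F} \<union> {(compl a, a) | a. {a} \<in> F}\<rparr>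
      = {(a, b). {compl a, b} \<in> F}" for V :: "'a lit set"
    by simp (force intro: exI[of _ "compl _"])
  then show ?thesis
    by (simp add: idg_def)
qed

lemma vwalk_arcs_eq_zip: "vwalk_arcs p = zip p (tl p)"
  by (induction p rule: vwalk_arcs.induct) auto

lemma set_vwalk_arcs: "set (vwalk_arcs p) = {(p ! i, p ! Suc i) | i. Suc i < length p}"
proof -
  have "i < length (tl p) \<longleftrightarrow> Suc i < length p" for i
    by auto
  then show ?thesis
    by (force simp: vwalk_arcs_eq_zip set_zip nth_tl)
qed

lemma last_vwalk_arcs:
  assumes "length p = Suc (Suc m)"
  shows "last (vwalk_arcs p) = (p ! m, p ! Suc m)"
proof -
  have "length (vwalk_arcs p) = Suc m"
    using assms by (simp add: vwalk_arcs_eq_zip)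
  then have "last (vwalk_arcs p) = vwalk_arcs p ! m"
    by (metis diff_Suc_1 last_conv_nth length_0_conv nat.distinct(1))
  then show ?thesis
    using assms by (simp add: vwalk_arcs_eq_zip nth_tl)
qed

lemma vwalk_idg_iff:
  "vwalk p (idg F) \<longleftrightarrow> p \<noteq> [] \<and> set p \<subseteq> {a. var a \<in> var ` \<Union>F} \<and>
     (\<forall>i. Suc i < length p \<longrightarrow> {compl (p ! i), p ! Suc i} \<in> F)"
  by (auto simp: vwalk_def verts_idg arcs_ends_idg set_vwalk_arcs)


section \<open>Lassos\<close>

text \<open>Indexing \<open>{p ! 0}\<close> as link \<open>0\<close> places \<open>p ! j\<close> in link \<open>j\<close> and its complement in link
  \<open>Suc j\<close>, with no exception at the initial vertex.\<close>

definition link :: "'v lit list \<Rightarrow> nat \<Rightarrow> 'v clause" where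
  "link p i = (if i = 0 then {p ! 0} else {compl (p ! (i - 1)), p ! i})"

text \<open>The vertex sequence of a nearly regular path of length \<open>n\<close> whose last vertex is
  complementary to vertex number \<open>k\<close>.\<close>

locale lasso =
  fixes p :: "'v lit list" and n k :: nat
  assumes len: "length p = Suc n" and k_less: "k < n"
    and final: "p ! n = compl (p ! k)"
    and inj: "\<And>i j. i < n \<Longrightarrow> j < n \<Longrightarrow> var (p ! i) = var (p ! j) \<Longrightarrow> i = j"

text \<open>Regularity of all but the last vertex forces the complementary pair to involve the last
  vertex; the position of its complement is \<open>k\<close>. Since \<open>nearly_regular\<close>
  looks only at sets of vertices, \<open>distinct p\<close> is added: together with regularity it
  yields \<open>inj\<close>.\<close>

lemma nearly_regular_iff_lasso:
  "nearly_regular p \<and> distinct p \<longleftrightarrow> (\<exists>n k. lasso p n k)"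
proof
  assume *: "nearly_regular p \<and> distinct p"
  then have card: "card (complementary_pairs (set p)) = 1" and reg: "regular (butlast p)"
    by (auto simp: nearly_regular_def)
  from card have "complementary_pairs (set p) \<noteq> {}" by auto
  then obtain a where a: "a \<in> set p" "compl a \<in> set p"
    by (auto simp: complementary_pairs_def)
  then obtain q w where p: "p = q @ [w]"
    by (metis append_butlast_last_id empty_iff list.set(1))
  have reg: "regular q" using reg p by simp
  have "a = w \<or> compl a = w"
    using a reg by (auto simp: p regular_iff)
  then have "compl w \<in> set q"
    using a by (auto simp: p)
  then obtain k where k: "k < length q" "q ! k = compl w"
    by (auto simp: in_set_conv_nth)
  have "lasso p (length q) k"
  proof
    fix i j assume ij: "i < length q" "j < length q" "var (p ! i) = var (p ! j)"
    then have "q ! i = q ! j \<or> q ! i = compl (q ! j)"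
      by (simp add: p nth_append var_eq_iff)
    moreover have "q ! i \<noteq> compl (q ! j)"
      using reg ij by (metis nth_mem regular_iff)
    moreover have "distinct q"
      using * by (simp add: p)
    ultimately show "i = j"
      using ij(1,2) by (simp add: nth_eq_iff_index_eq)
  qed (use k in \<open>auto simp: p nth_append\<close>)
  then show "\<exists>n k. lasso p n k" by blast
next
  assume "\<exists>n k. lasso p n k"
  then obtain n k where "lasso p n k" by blast
  then interpret lasso p n k .
  obtain q w where p: "p = q @ [w]"
    using len by (metis length_Suc_conv_rev)
  then have n: "length q = n" using len by simp
  have w: "w = compl (q ! k)"
    using final k_less n by (simp add: p nth_append)
  have inj': "i = j" if "i < n" "j < n" "var (q ! i) = var (q ! j)" for i j
    using inj[of i j] that n by (simp add: p nth_append)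
  have reg: "regular q"
    unfolding regular_iff
  proof
    fix a assume "a \<in> set q"
    then obtain i where i: "i < n" "a = q ! i"
      using n by (auto simp: in_set_conv_nth)
    show "compl a \<notin> set q"
    proof
      assume "compl a \<in> set q"
      then obtain j where j: "j < n" "q ! j = compl a"
        using n by (auto simp: in_set_conv_nth)
      then have "i = j" using inj' i by simp
      then show False using i j by simp
    qed
  qed
  have kq: "q ! k \<in> set q" using k_less n by simp
  then have "w \<notin> set q" using reg by (auto simp: w regular_iff)
  moreover have "distinct q"
    using inj' n by (auto simp: distinct_conv_nth)
  moreover have "complementary_pairs (set p) = {{w, compl w}}"
    using kq reg by (auto simp: complementary_pairs_def p w regular_iff insert_commute)
  ultimately show "nearly_regular p \<and> distinct p"
    using reg by (simp add: nearly_regular_def p)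
qed

text \<open>Counting arcs from \<open>0\<close>, arc \<open>i\<close> contributes link
  \<open>Suc i\<close>, and the additional clause \<open>{p ! 0}\<close> is link
  \<open>0\<close>.\<close>

lemma CL_eq_links:
  assumes "length p = Suc n"
  shows "CL (set (vwalk_arcs p)) \<union> {{p ! 0}} = link p ` {..n}"
proof -
  have "CL (set (vwalk_arcs p)) = (\<lambda>i. link p (Suc i)) ` {..<n}"
    using assms by (auto simp: CL_def set_vwalk_arcs link_def)
  moreover have "{..n} = insert 0 (Suc ` {..<n})"
    by (metis lessThan_Suc_atMost lessThan_Suc_eq_insert_0)
  ultimately show ?thesis
    by (simp add: image_image link_def[of p 0])
qed

section \<open>Occurrences of literals in the links\<close>

context lasso
begin

lemma nth_eq_iff: "i < n \<Longrightarrow> j < n \<Longrightarrow> p ! i = p ! j \<longleftrightarrow> i = j"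
  using inj by auto

lemma nth_neq_compl: "i < n \<Longrightarrow> j < n \<Longrightarrow> p ! i \<noteq> compl (p ! j)"
  using inj by (metis compl_neq(1) var_compl)

text \<open>Distinct variables separate the vertices before the last. Link \<open>n\<close> is
  treated apart, because \<open>p ! n\<close> repeats the variable of \<open>p ! k\<close>, but with
  opposite sign.\<close>

lemma nth_mem_link_iff:
  assumes "j < n" "i \<le> n"
  shows "p ! j \<in> link p i \<longleftrightarrow> i = j"
proof (cases "i = n")
  case True
  then show ?thesis
    using assms k_less nth_neq_compl[of j k] nth_neq_compl[of j "n - 1"]
    by (auto simp: link_def final)
next
  case False
  then show ?thesis
    using assms nth_neq_compl[of j "i - 1"] nth_eq_iff[of j i]
    by (auto simp: link_def)
qed

text \<open>The extra occurrence comes from \<open>p ! n = compl (p ! k)\<close>; it accounts for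
  the variable of degree 3 and for the two directions around the loop.\<close>

lemma compl_nth_mem_link_iff:
  assumes "j < n" "i \<le> n"
  shows "compl (p ! j) \<in> link p i \<longleftrightarrow> i = Suc j \<or> i = n \<and> j = k"
proof (cases "i = n")
  case True
  then show ?thesis
    using assms k_less nth_eq_iff[of j k] nth_eq_iff[of j "n - 1"]
    by (auto simp: link_def final)
next
  case False
  then have "compl (p ! j) \<noteq> p ! i"
    using assms nth_neq_compl[of i j] by (metis le_neq_implies_less)
  then show ?thesis
    using False assms nth_eq_iff[of j "i - 1"]
    by (auto simp: link_def)
qed

text \<open>For \<open>i < n\<close> the literal \<open>p ! i\<close> occurs in link
  \<open>i\<close> alone and so identifies it; only the single index \<open>n\<close> is left
  without such a mark.\<close>

lemma inj_on_link: "inj_on (link p) {..n}"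
proof -
  have less: "i = j" if "i < n" "j \<le> n" "link p i = link p j" for i j
  proof -
    have "p ! i \<in> link p i"
      using nth_mem_link_iff[of i i] that(1) by simp
    then have "p ! i \<in> link p j"
      unfolding that(3) .
    then show ?thesis
      using nth_mem_link_iff[OF that(1,2)] by simp
  qed
  show ?thesis
  proof (rule inj_onI)
    fix i j assume ij: "i \<in> {..n}" "j \<in> {..n}" and eq: "link p i = link p j"
    consider "i < n" | "j < n" | "i = n" "j = n" using ij by fastforce
    then show "i = j"
    proof cases
      case 1
      then show ?thesis using less[OF _ _ eq] ij by simp
    next
      case 2
      then show ?thesis using less[OF _ _ eq[symmetric]] ij by simp
    qed simp
  qed
qed

section \<open>Number of links, variable degrees and unit-clauses\<close>

lemma card_links: "card (link p ` {..n}) = Suc n"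
  using inj_on_link by (simp add: card_image)

text \<open>The links concerned are \<open>j\<close>, \<open>Suc j\<close> and, for
  \<open>j = k\<close>, also \<open>n\<close>. If \<open>n = Suc k\<close>, the last two coincide
  and the degree stays 2.\<close>

lemma vdeg_nth:
  assumes "j < n"
  shows "vdeg (link p ` {..n}) (var (p ! j)) = (if j = k \<and> Suc k < n then 3 else 2)"
proof -
  have "{C \<in> link p ` {..n}. p ! j \<in> C \<or> compl (p ! j) \<in> C} =
      link p ` ({j, Suc j} \<union> (if j = k then {n} else {}))" (is "_ = link p ` ?I")
    using assms nth_mem_link_iff compl_nth_mem_link_iff by auto
  moreover have "card (link p ` ?I) = card ?I"
    using assms by (intro card_image inj_on_subset[OF inj_on_link]) auto
  moreover have "card ?I = (if j = k \<and> Suc k < n then 3 else 2)"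
    using assms k_less by (auto simp: card_insert_if)
  ultimately show ?thesis
    by (simp add: vdeg_var)
qed

lemma vdeg_other:
  assumes "v \<notin> var ` (!) p ` {..<n}"
  shows "vdeg (link p ` {..n}) v = 0"
proof -
  have *: "var (p ! i) \<noteq> v" if "i \<le> n" for i
    using that assms k_less by (cases "i = n") (auto simp: final)
  have "var a \<noteq> v" if "i \<le> n" "a \<in> link p i" for a i
  proof -
    have "i - 1 \<le> n" using that(1) by simp
    then show ?thesis
      using that(2) *[OF that(1)] *[of "i - 1"] by (auto simp: link_def split: if_splits)
  qed
  then have "{C \<in> link p ` {..n}. \<exists>a\<in>C. var a = v} = {}"
    by auto
  then show ?thesis
    by (simp add: vdeg_def mem_vars_iff)
qed

lemma vdeg_eq_3:
  assumes "Suc k < n"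
  shows "{v. vdeg (link p ` {..n}) v = 3} = {var (p ! k)}"
proof -
  have "v = var (p ! k)" if "vdeg (link p ` {..n}) v = 3" for v
  proof -
    from that have "v \<in> var ` (!) p ` {..<n}"
      using vdeg_other by fastforce
    then show ?thesis
      using that vdeg_nth by (auto split: if_splits)
  qed
  moreover have "vdeg (link p ` {..n}) (var (p ! k)) = 3"
    using assms vdeg_nth[of k] k_less by simp
  ultimately show ?thesis by blast
qed

text \<open>The last link is \<open>{compl (p ! (n - 1)), compl (p ! k)}\<close>, which collapses to
  a unit-clause iff \<open>n - 1 = k\<close>.\<close>

lemma card_link:
  assumes "i \<le> n"
  shows "card (link p i) = (if i = 0 \<or> i = n \<and> n = Suc k then 1 else 2)"
proof (cases "i = n")
  case True
  then show ?thesis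
    using k_less nth_eq_iff[of "n - 1" k] by (auto simp: link_def final card_insert_if)
next
  case False
  then have "i < n" using assms by simp
  then have "p ! i \<noteq> compl (p ! (i - 1))"
    by (intro nth_neq_compl) auto
  then show ?thesis
    using False by (auto simp: link_def card_insert_if)
qed

lemma unit_clauses_links:
  "unit_clauses (link p ` {..n}) = (if n = Suc k then {{p ! 0}, {p ! n}} else {{p ! 0}})"
proof -
  have link_0: "link p 0 = {p ! 0}"
    by (simp add: link_def)
  have "i \<le> n \<and> card (link p i) = 1 \<longleftrightarrow> i = 0 \<or> i = n \<and> n = Suc k" for i
  proof (cases "i \<le> n")
    case True
    show ?thesis unfolding card_link[OF True] using True by simp
  qed auto
  then have "link p ` {i. i \<le> n \<and> card (link p i) = 1} = link p ` {i. i = 0 \<or> i = n \<and> n = Suc k}"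
    by (simp only:)
  moreover have "unit_clauses (link p ` {..n}) = link p ` {i. i \<le> n \<and> card (link p i) = 1}"
    by (auto simp: unit_clauses_def)
  ultimately have units: "unit_clauses (link p ` {..n}) = link p ` {i. i = 0 \<or> i = n \<and> n = Suc k}"
    by (simp only:)
  show ?thesis
  proof (cases "n = Suc k")
    case True
    then have "n - 1 = k" by simp
    then have "link p n = {p ! n}"
      using k_less final by (simp add: link_def)
    moreover have "{i. i = 0 \<or> i = n \<and> n = Suc k} = {0, n}"
      using True by blast
    ultimately show ?thesis
      unfolding units if_P[OF True] by (simp only: image_insert image_empty link_0)
  next
    case False
    then have "{i. i = 0 \<or> i = n \<and> n = Suc k} = {0}"
      by blast
    then show ?thesis
      unfolding units if_not_P[OF False] by (simp only: image_insert image_empty link_0)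
  qed
qed

lemma card_unit_clauses_links:
  "card (unit_clauses (link p ` {..n})) = (if n = Suc k then 2 else 1)"
proof -
  have "p ! 0 \<noteq> p ! n"
    using k_less nth_neq_compl[of 0 k] by (simp add: final)
  then have "card {{p ! 0}, {p ! n}} = 2" by simp
  then show ?thesis
    unfolding unit_clauses_links if_distrib[of card] by (rule if_cong[OF refl]) simp
qed

section \<open>Minimal unsatisfiability of the links\<close>

lemma links_unsatisfiable: "\<not> satisfiable (link p ` {..n})"
proof
  assume "satisfiable (link p ` {..n})"
  then obtain \<phi> where \<phi>: "\<And>i. i \<le> n \<Longrightarrow> \<exists>a\<in>link p i. lit_true \<phi> a"
    by (auto simp: satisfiable_def)
  \<comment> \<open>Truth propagates along the path: link \<open>0\<close> makes
    \<open>p ! 0\<close> true, and link \<open>Suc i\<close> passes truth from \<open>p ! i\<close>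
    to \<open>p ! Suc i\<close>. Hence \<open>p ! k\<close> and its complement \<open>p ! n\<close>
    would both be true.\<close>
  have "lit_true \<phi> (p ! i)" if "i \<le> n" for i
    using that
  proof (induction i)
    case (Suc i)
    then show ?case using \<phi>[of "Suc i"] by (auto simp: link_def)
  qed (use \<phi>[of 0] in \<open>auto simp: link_def\<close>)
  from this[of n] this[of k] show False
    using k_less by (simp add: final)
qed

text \<open>Without link \<open>m\<close>, make \<open>p ! 0, \<dots>, p ! (m - 1)\<close> true and
  \<open>p ! m, \<dots>, p ! (n - 1)\<close> false.\<close>

lemma links_minus_satisfiable:
  assumes "m \<le> n"
  shows "satisfiable (link p ` {..n} - {link p m})"
proof -
  \<comment> \<open>Only the variables that have to be true are listed; all others, including those
    off the path, default to false. By \<open>inj\<close> the two disjuncts never conflict with the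
    intended values.\<close>
  define \<phi> where "\<phi> v \<longleftrightarrow> (\<exists>j<m. p ! j = Pos v) \<or> (\<exists>j. m \<le> j \<and> j < n \<and> p ! j = Neg v)" for v
  have \<phi>: "lit_true \<phi> (p ! j) \<longleftrightarrow> j < m" if "j < n" for j
  proof (cases "p ! j")
    case (Pos v)
    then have "p ! i = Pos v \<longleftrightarrow> i = j" "p ! i \<noteq> Neg v" if "i < n" for i
      using \<open>j < n\<close> that nth_eq_iff[of i j] nth_neq_compl[of i j] by auto
    then show ?thesis
      unfolding Pos lit_true.simps \<phi>_def using that assms by auto
  next
    case (Neg v)
    then have "p ! i = Neg v \<longleftrightarrow> i = j" "p ! i \<noteq> Pos v" if "i < n" for i
      using \<open>j < n\<close> that nth_eq_iff[of i j] nth_neq_compl[of i j] by auto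
    then show ?thesis
      unfolding Neg lit_true.simps \<phi>_def using that assms by auto
  qed
  have "\<exists>a\<in>link p i. lit_true \<phi> a" if "i \<le> n" "i \<noteq> m" for i
  proof (cases "i < m")
    case True
    then show ?thesis
      using \<phi>[of i] assms by (intro bexI[of _ "p ! i"]) (auto simp: link_def)
  next
    case False
    then show ?thesis
      using \<phi>[of "i - 1"] that by (intro bexI[of _ "compl (p ! (i - 1))"]) (auto simp: link_def)
  qed
  then show ?thesis
    unfolding satisfiable_def by (intro exI[of _ \<phi>]) auto
qed

lemma links_minimally_unsat:
  assumes "clause_set (link p ` {..n})"
  shows "minimally_unsat (link p ` {..n})"
  unfolding minimally_unsat_def
proof (intro conjI ballI)
  fix C assume "C \<in> link p ` {..n}"
  then obtain m where "m \<le> n" "C = link p m" by blast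
  then show "satisfiable (link p ` {..n} - {C})"
    using links_minus_satisfiable by simp
qed (fact assms links_unsatisfiable)+

end


section \<open>Reversing the loop\<close>

text \<open>The loop from \<open>p ! k\<close> to \<open>p ! n\<close> is replaced by its
  contraposition. The index \<open>n + k - j\<close> exchanges \<open>k\<close> and
  \<open>n\<close>, and for a lasso \<open>compl (p ! n) = p ! k\<close>, so the new loop attaches
  to the unchanged stem.\<close>

definition flip :: "'v lit list \<Rightarrow> nat \<Rightarrow> nat \<Rightarrow> 'v lit list" where
  "flip p n k = map (\<lambda>j. if j \<le> k then p ! j else compl (p ! (n + k - j))) [0..<Suc n]"

lemma nth_flip: "j \<le> n \<Longrightarrow> flip p n k ! j = (if j \<le> k then p ! j else compl (p ! (n + k - j)))"
  unfolding flip_def by (subst nth_map) (auto simp del: upt_Suc)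

context lasso
begin

lemma lasso_flip: "lasso (flip p n k) n k"
proof
  show "length (flip p n k) = Suc n" by (simp add: flip_def)
  show "k < n" by (rule k_less)
  show "flip p n k ! n = compl (flip p n k ! k)"
    using k_less by (simp add: nth_flip)
  \<comment> \<open>Up to complement, vertex \<open>i\<close> of the flipped path is vertex
    \<open>?s i\<close> of \<open>p\<close>; below \<open>n\<close> this map is injective and stays
    below \<open>n\<close>.\<close>
  let ?s = "\<lambda>i. if i \<le> k then i else n + k - i"
  fix i j assume ij: "i < n" "j < n" "var (flip p n k ! i) = var (flip p n k ! j)"
  then have "var (p ! ?s i) = var (p ! ?s j)"
    by (auto simp: nth_flip split: if_splits)
  then have "?s i = ?s j"
    using ij k_less by (intro inj) auto
  then show "i = j"
    using ij by (auto split: if_splits)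
qed

text \<open>Contraposition exchanges the two arcs of one clause, so the loop uses the same links in
  reverse order. The sum of indices is \<open>n + k + 1\<close> rather than \<open>n + k\<close>,
  because link \<open>i\<close> joins vertices \<open>i - 1\<close> and \<open>i\<close>.\<close>

lemma link_flip:
  assumes "i \<le> n"
  shows "link (flip p n k) i = link p (if i \<le> k then i else n + k + 1 - i)"
proof -
  consider "i \<le> k" | "i = Suc k" | "Suc k < i" by linarith
  then show ?thesis
  proof cases
    case 1
    then show ?thesis using assms by (auto simp: link_def nth_flip)
  next
    case 2
    then show ?thesis using assms k_less by (auto simp: link_def nth_flip final)
  next
    case 3
    then have "n + k - (i - 1) = n + k + 1 - i" by simp
    with 3 show ?thesis using assms by (auto simp: link_def nth_flip)
  qed
qed

lemma links_flip: "link (flip p n k) ` {..n} = link p ` {..n}"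
proof -
  let ?t = "\<lambda>i. if i \<le> k then i else n + k + 1 - i"
  have "?t ` {..n} = {..n}"
  proof
    show "?t ` {..n} \<subseteq> {..n}" using k_less by auto
    show "{..n} \<subseteq> ?t ` {..n}"
    proof
      fix i assume "i \<in> {..n}"
      \<comment> \<open>The reindexing is an involution, so \<open>?t i\<close> is its own
        witness.\<close>
      then show "i \<in> ?t ` {..n}"
        using k_less by (intro image_eqI[of _ _ "?t i"]) auto
    qed
  qed
  then have "link p ` {..n} = link p ` ?t ` {..n}" by simp
  also have "\<dots> = link (flip p n k) ` {..n}"
    unfolding image_image by (intro image_cong refl link_flip[symmetric]) simp
  finally show ?thesis ..
qed

text \<open>A loop of length at least 2 has an inner vertex; equality would make the first and the
  last inner vertex complementary, though both lie in the regular part.\<close>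

lemma flip_neq:
  assumes "Suc k < n"
  shows "flip p n k \<noteq> p"
proof
  assume "flip p n k = p"
  then have "p ! Suc k = compl (p ! (n - 1))"
    using nth_flip[of "Suc k" n p k] assms by simp
  then show False
    using assms nth_neq_compl[of "Suc k" "n - 1"] by simp
qed

lemma last_eq: "last p = compl (p ! k)"
  using len final by (metis diff_Suc_1 last_conv_nth length_0_conv nat.distinct(1))

lemma flip_eq_self:
  assumes "n = Suc k"
  shows "flip p n k = p"
proof (rule nth_equalityI)
  show "length (flip p n k) = length p"
    by (simp add: len flip_def)
  fix i assume "i < length (flip p n k)"
  then have "i \<le> k \<or> i = n"
    using assms by (auto simp: flip_def)
  then show "flip p n k ! i = p ! i"
    using k_less final by (auto simp: nth_flip)
qed

text \<open>For \<open>k = 0\<close> the loop is the entire path. Only index \<open>0\<close> needs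
  \<open>final\<close>: there \<open>flip\<close> keeps \<open>p ! 0\<close>, while contraposition
  yields \<open>compl (p ! n)\<close>.\<close>

lemma flip_eq_contraposition:
  assumes "k = 0"
  shows "flip p n k = contraposition p"
proof (rule nth_equalityI)
  show "length (flip p n k) = length (contraposition p)"
    by (simp add: len flip_def contraposition_def)
  fix i assume "i < length (flip p n k)"
  then have i: "i \<le> n"
    by (simp add: flip_def)
  then have "contraposition p ! i = compl (p ! (n - i))"
    using len by (simp add: contraposition_def rev_nth)
  then show "flip p n k ! i = contraposition p ! i"
    using i assms final by (cases "i = 0") (simp_all add: nth_flip)
qed

lemma takeWhile_eq: "takeWhile (\<lambda>a. a \<noteq> compl (last p)) p = take k p"
proof (rule takeWhile_eq_take_P_nth)
  fix i assume "i < k"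
  then show "p ! i \<noteq> compl (last p)"
    using k_less nth_eq_iff[of i k] by (simp add: last_eq)
qed (simp add: last_eq)

lemma flip_eq_join:
  "flip p n k = vwalk_join (regular_part0 p) (contraposition (regular_part1 p))"
proof -
  have len_take: "length (take k p) = k" using len k_less by simp
  have 0: "regular_part0 p = take (Suc k) p"
    unfolding regular_part0_def takeWhile_eq
    using len k_less by (simp add: last_eq take_Suc_conv_app_nth)
  have 1: "regular_part1 p = drop k p"
    unfolding regular_part1_def dropWhile_eq_drop takeWhile_eq len_take ..
  show ?thesis
  proof (rule nth_equalityI)
    show "length (flip p n k) =
        length (vwalk_join (regular_part0 p) (contraposition (regular_part1 p)))"
      using len k_less by (simp add: flip_def vwalk_join_def 0 1 contraposition_def)
    fix j assume "j < length (flip p n k)"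
    then have j: "j \<le> n" by (simp add: flip_def)
    show "flip p n k ! j = vwalk_join (regular_part0 p) (contraposition (regular_part1 p)) ! j"
    proof (cases "j \<le> k")
      case True
      then show ?thesis
        using j len k_less by (simp add: nth_flip vwalk_join_def 0 nth_append)
    next
      case False
      \<comment> \<open>Vertex \<open>j\<close> lies in the contraposed loop at offset
        \<open>j - k\<close>, hence comes from offset \<open>n - j\<close> in
        \<open>drop k p\<close>.\<close>
      then have "k + (n - j) = n + k - j"
        using j by simp
      with False show ?thesis
        using j len k_less
        by (simp add: nth_flip vwalk_join_def 0 1 nth_append contraposition_def nth_tl rev_nth
            Suc_diff_Suc)
    qed
  qed
qed

text \<open>A path through the clauses of \<open>p\<close> is forced by its first vertex, except that at vertex
  \<open>k\<close> it may enter the loop in either direction.\<close>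

lemma lasso_unique:
  assumes "lasso q n' k'" "q ! 0 = p ! 0" "link q ` {..n'} = link p ` {..n}"
  shows "q = p \<or> q = flip p n k"
proof -
  interpret q: lasso q n' k' by fact
  have "n' = n"
    using card_links q.card_links assms(3) by simp
  have link: "\<exists>i\<le>n. link p i = {compl (q ! j), q ! Suc j}" if "j < n" for j
  proof -
    have "link q (Suc j) \<in> link p ` {..n}"
      using that \<open>n' = n\<close> by (auto simp: assms(3)[symmetric])
    then show ?thesis by (auto simp: link_def[of q])
  qed
  \<comment> \<open>A step from \<open>p ! j\<close> uses a clause containing
    \<open>compl (p ! j)\<close>: link \<open>Suc j\<close>, or link \<open>n\<close> if
    \<open>j = k\<close>.\<close>
  have forward: "q ! Suc j = p ! Suc j \<or> j = k \<and> q ! Suc j = compl (p ! (n - 1))"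
    if j: "j < n" and eq: "q ! j = p ! j" for j
  proof -
    obtain i where i: "i \<le> n" "link p i = {compl (p ! j), q ! Suc j}"
      using link[OF j] eq by auto
    then have "i = Suc j \<or> i = n \<and> j = k"
      using compl_nth_mem_link_iff[of j i] j by simp
    then show ?thesis
      using i j by (auto simp: link_def final doubleton_eq_iff)
  qed
  \<comment> \<open>Against the direction of \<open>p\<close>, a step from
    \<open>compl (p ! i)\<close> uses a clause containing \<open>p ! i\<close>, and only link
    \<open>i\<close> does.\<close>
  have backward: "q ! Suc j = compl (p ! (i - 1))"
    if j: "j < n" and i: "0 < i" "i < n" and eq: "q ! j = compl (p ! i)" for j i
  proof -
    obtain i' where i': "i' \<le> n" "link p i' = {p ! i, q ! Suc j}"
      using link[OF j] eq by auto
    then have "i' = i"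
      using nth_mem_link_iff[of i i'] i by simp
    then show ?thesis
      using i' i by (auto simp: link_def doubleton_eq_iff)
  qed
  have stem: "q ! j = p ! j" if "j \<le> k" for j
    using that
  proof (induction j)
    case (Suc j)
    then show ?case using forward[of j] k_less by auto
  qed (rule assms(2))
  have "q ! Suc k = p ! Suc k \<or> q ! Suc k = compl (p ! (n - 1))"
    using forward[of k] stem[of k] k_less by auto
  then show ?thesis
  proof
    assume eq: "q ! Suc k = p ! Suc k"
    have "q ! j = p ! j" if "Suc k \<le> j" "j \<le> n" for j
      using that
    proof (induction j rule: dec_induct)
      case (step j)
      then show ?case using forward[of j] by auto
    qed (rule eq)
    then have "q ! j = p ! j" if "j \<le> n" for j
      using that stem[of j] by (cases "j \<le> k") auto
    then have "q = p"
      using len q.len \<open>n' = n\<close> by (intro nth_equalityI) auto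
    then show ?thesis ..
  next
    assume eq: "q ! Suc k = compl (p ! (n - 1))"
    have "q ! j = compl (p ! (n + k - j))" if "Suc k \<le> j" "j \<le> n" for j
      using that
    proof (induction j rule: dec_induct)
      case (step j)
      then have "n + k - Suc j = n + k - j - 1" by simp
      then show ?case using step backward[of j "n + k - j"] by auto
    qed (use eq in simp)
    then have "q ! j = flip p n k ! j" if "j \<le> n" for j
      using that stem[of j] by (cases "j \<le> k") (auto simp: nth_flip)
    then have "q = flip p n k"
      using q.len \<open>n' = n\<close> by (intro nth_equalityI) (auto simp: flip_def simp del: upt_Suc)
    then show ?thesis ..
  qed
qed

end


section \<open>Nearly regular paths as lassos\<close>

lemma path_clauses_lasso:
  assumes "lasso p n k"
  shows "path_clauses (p ! 0) p = link p ` {..n}"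
  using CL_eq_links[OF lasso.len[OF assms]] by (simp add: path_clauses_def)

text \<open>Arcs of the path are links with positive index, and \<open>{x}\<close> supplies link
  \<open>0\<close>. Thus all conditions on the digraph become one inclusion, which is easy to
  transfer between \<open>F\<close> and its subsets.\<close>

lemma nearly_regular_paths_iff:
  assumes "{x} \<in> F"
  shows "p \<in> nearly_regular_paths x (idg F) \<longleftrightarrow>
    (\<exists>n k. lasso p n k \<and> p ! 0 = x \<and> link p ` {..n} \<subseteq> F)"
proof
  assume *: "p \<in> nearly_regular_paths x (idg F)"
  then obtain n k where l: "lasso p n k"
    using nearly_regular_iff_lasso[of p] by (auto simp: nearly_regular_paths_def vpath_def)
  then have len: "length p = Suc n" by (rule lasso.len)
  then have "p \<noteq> []" by auto
  then have x: "p ! 0 = x"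
    using * by (auto simp: nearly_regular_paths_def hd_conv_nth)
  have "{compl (p ! i), p ! Suc i} \<in> F" if "i < n" for i
    using * that len by (auto simp: nearly_regular_paths_def vpath_def vwalk_idg_iff)
  then have "link p i \<in> F" if "i \<le> n" for i
    using that x assms by (cases i) (auto simp: link_def)
  then show "\<exists>n k. lasso p n k \<and> p ! 0 = x \<and> link p ` {..n} \<subseteq> F"
    using l x by auto
next
  assume "\<exists>n k. lasso p n k \<and> p ! 0 = x \<and> link p ` {..n} \<subseteq> F"
  then obtain n k where l: "lasso p n k" and x: "p ! 0 = x"
    and sub: "link p ` {..n} \<subseteq> F"
    by blast
  have F: "link p i \<in> F" if "i \<le> n" for i
    using sub that by blast
  have len: "length p = Suc n" using l by (rule lasso.len)
  have "{compl (p ! i), p ! Suc i} \<in> F" if "i < n" for i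
    using F[of "Suc i"] that by (simp add: link_def)
  moreover have "var (p ! i) \<in> var ` \<Union>F" if "i \<le> n" for i
    using F[of i] that by (force simp: link_def split: if_splits)
  ultimately have "vwalk p (idg F)"
    using len by (auto simp: vwalk_idg_iff in_set_conv_nth)
  moreover have "p \<noteq> []" using len by auto
  ultimately show "p \<in> nearly_regular_paths x (idg F)"
    using l x nearly_regular_iff_lasso[of p]
    by (auto simp: nearly_regular_paths_def vpath_def hd_conv_nth)
qed

section \<open>Existence of nearly regular paths\<close>

lemma vpath_idg_snoc:
  assumes "vpath p (idg F)" "{compl (last p), w} \<in> F" "w \<notin> set p"
  shows "vpath (p @ [w]) (idg F)"
proof -
  have "vwalk (p @ [w]) (idg F)"
    using assms by (force simp: vpath_def vwalk_def verts_idg arcs_ends_idg vwalk_arcs_append)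
  then show ?thesis using assms by (simp add: vpath_def)
qed

text \<open>Extend a regular path by one arc to \<open>w\<close>. If \<open>w\<close> is already on
  it, cut it there; if \<open>compl w\<close> is on it, the extension is nearly regular; otherwise
  the extension is again regular.\<close>

lemma regular_or_nearly_regular_path:
  assumes "(x, u) \<in> {(a, b). {compl a, b} \<in> F}\<^sup>*" "{x} \<in> F"
  shows "nearly_regular_paths x (idg F) \<noteq> {} \<or>
    (\<exists>p. vpath p (idg F) \<and> regular p \<and> hd p = x \<and> last p = u)"
  using assms(1)
proof (induction rule: rtrancl_induct)
  case base
  have "vpath [x] (idg F)"
    using assms(2) by (force simp: vpath_def vwalk_idg_iff)
  then show ?case
    by (intro disjI2 exI[of _ "[x]"]) (auto simp: regular_iff)
next
  case (step u w)
  show ?case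
  proof (cases "nearly_regular_paths x (idg F) = {}")
    case True
    with step obtain p where p: "vpath p (idg F)" "regular p" "hd p = x" "last p = u"
      by auto
    show ?thesis
    proof (cases "w \<in> set p")
      case True
      then obtain r s where rs: "p = (r @ [w]) @ s"
        by (metis append.assoc append_Cons append_Nil split_list)
      then have "vpath (r @ [w]) (idg F)"
        using p(1) vwalkI_append_l[of "r @ [w]" s "idg F"] by (auto simp: vpath_def)
      moreover have "regular (r @ [w])"
        using p(2) by (auto simp: rs regular_iff)
      moreover have "hd (r @ [w]) = x"
        using p(3) by (auto simp: rs hd_append)
      ultimately show ?thesis by fastforce
    next
      case False
      with p step have path: "vpath (p @ [w]) (idg F)"
        by (intro vpath_idg_snoc) auto
      have hd: "hd (p @ [w]) = x"
        using p by (auto simp: vpath_def vwalk_def)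
      show ?thesis
      proof (cases "compl w \<in> set p")
        case True
        have "complementary_pairs (set (p @ [w])) = {{w, compl w}}"
          using p(2) True by (auto simp: complementary_pairs_def regular_iff insert_commute)
        then have "p @ [w] \<in> nearly_regular_paths x (idg F)"
          using path hd p(2) by (simp add: nearly_regular_paths_def nearly_regular_def)
        then show ?thesis by blast
      next
        case compl: False
        have "regular (p @ [w])"
          using p(2) False compl by (auto simp: regular_iff)
        then show ?thesis
          using path hd by (metis last_snoc)
      qed
    qed
  qed simp
qed

text \<open>Each clause yields an arc together with its contraposition, so reachability is
  skew-symmetric.\<close>

lemma rtrancl_contrapositive:
  assumes "(a, b) \<in> {(a, b). {compl a, b} \<in> F}\<^sup>*"
  shows "(compl b, compl a) \<in> {(a, b). {compl a, b} \<in> F}\<^sup>*"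
  using assms
proof (induction rule: rtrancl_induct)
  case (step b c)
  then have "(compl c, compl b) \<in> {(a, b). {compl a, b} \<in> F}"
    by (simp add: insert_commute)
  then show ?case using step.IH by (rule converse_rtrancl_into_rtrancl)
qed simp

text \<open>The literals reachable from \<open>x\<close> are closed under the clauses they touch; if they were
  free of complementary pairs, making them true would extend a satisfying assignment of the
  other clauses. By contraposition, reaching a complementary pair means reaching \<open>compl x\<close>.\<close>

lemma minimally_unsat_reaches_compl:
  assumes mu: "minimally_unsat F" and x: "{x} \<in> F" and card: "\<forall>C\<in>F. card C = 1 \<or> card C = 2"
  shows "(x, compl x) \<in> {(a, b). {compl a, b} \<in> F}\<^sup>*" (is "_ \<in> ?E\<^sup>*")
proof (rule ccontr)
  assume nr: "(x, compl x) \<notin> ?E\<^sup>*"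
  define R where "R = {u. (x, u) \<in> ?E\<^sup>*}"
  have closed: "b \<in> R" if "compl a \<in> R" "{a, b} \<in> F" for a b
  proof -
    have "(compl a, b) \<in> ?E" using that by simp
    then show ?thesis using that(1) by (auto simp: R_def intro: rtrancl_into_rtrancl)
  qed
  have reg: "compl u \<notin> R" if "u \<in> R" for u
  proof
    assume "compl u \<in> R"
    then have "(x, compl u) \<in> ?E\<^sup>*" by (simp add: R_def)
    moreover have "(compl u, compl x) \<in> ?E\<^sup>*"
      using that by (intro rtrancl_contrapositive) (simp add: R_def)
    ultimately show False using nr by (meson rtrancl_trans)
  qed
  from mu x have "satisfiable (F - {{x}})"
    by (simp add: minimally_unsat_def)
  then obtain \<phi> where \<phi>: "\<And>C. C \<in> F \<Longrightarrow> C \<noteq> {x} \<Longrightarrow> \<exists>a\<in>C. lit_true \<phi> a"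
    by (auto simp: satisfiable_def)
  \<comment> \<open>Literals in \<open>R\<close> become true, their complements false; every other
    variable keeps its value under \<open>\<phi>\<close>.\<close>
  define \<psi> where "\<psi> v \<longleftrightarrow> Pos v \<in> R \<or> Neg v \<notin> R \<and> \<phi> v" for v
  have true: "lit_true \<psi> a" if "a \<in> R" for a
    using that reg[of a] by (cases a) (auto simp: \<psi>_def)
  have keep: "lit_true \<psi> a \<longleftrightarrow> lit_true \<phi> a" if "a \<notin> R" "compl a \<notin> R" for a
    using that by (cases a) (auto simp: \<psi>_def)
  have xR: "x \<in> R" by (simp add: R_def)
  have "\<exists>c\<in>C. lit_true \<psi> c" if C: "C \<in> F" for C
  proof (cases "\<exists>c\<in>C. c \<in> R")
    case True
    then show ?thesis using true by blast
  next
    case False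
    \<comment> \<open>Here \<open>a = b\<close> is allowed, so unit-clauses need no separate
      case.\<close>
    obtain a b where ab: "C = {a, b}"
      using card C by (metis card_1_singletonE card_2_iff insert_absorb2)
    have "compl a \<notin> R" "compl b \<notin> R"
      using False C closed[of a b] closed[of b a] by (auto simp: ab insert_commute)
    moreover have "C \<noteq> {x}" using False xR by auto
    ultimately show ?thesis
      using False \<phi>[OF C] keep by (auto simp: ab)
  qed
  then have "satisfiable F" by (auto simp: satisfiable_def)
  with mu show False by (simp add: minimally_unsat_def)
qed

section \<open>Image and preimages of the path map\<close>

lemma minimally_unsat_subset_eq:
  assumes "minimally_unsat G" "F \<subseteq> G" "\<not> satisfiable F"
  shows "F = G"
proof (rule ccontr)
  assume "F \<noteq> G"
  then obtain C where C: "C \<in> G" "F \<subseteq> G - {C}" using assms(2) by blast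
  then have "satisfiable (G - {C})" using assms(1) by (simp add: minimally_unsat_def)
  with C(2) have "satisfiable F" unfolding satisfiable_def by (meson subsetD)
  with assms(3) show False ..
qed

text \<open>Flipping preserves the links and \<open>lasso_unique\<close> excludes any further path.
  The two listed paths may coincide.\<close>

lemma path_preimage_lasso:
  assumes "{x} \<in> F" "lasso p n k" "p ! 0 = x" "link p ` {..n} \<subseteq> F"
  shows "path_preimage F x (link p ` {..n}) = {p, flip p n k}"
proof -
  interpret lasso p n k by fact
  have "p \<in> path_preimage F x (link p ` {..n})"
    unfolding path_preimage_def nearly_regular_paths_iff[OF assms(1)]
    using assms path_clauses_lasso[OF assms(2)] by blast
  moreover have "flip p n k \<in> path_preimage F x (link p ` {..n})"
  proof -
    have x: "flip p n k ! 0 = x" using assms(3) by (simp add: nth_flip)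
    with lasso_flip assms(1,4) links_flip have "flip p n k \<in> nearly_regular_paths x (idg F)"
      unfolding nearly_regular_paths_iff[OF assms(1)] by metis
    then show ?thesis
      using path_clauses_lasso[OF lasso_flip] x links_flip by (simp add: path_preimage_def)
  qed
  moreover have "q = p \<or> q = flip p n k" if "q \<in> path_preimage F x (link p ` {..n})" for q
  proof -
    from that have "q \<in> nearly_regular_paths x (idg F)" "path_clauses x q = link p ` {..n}"
      by (auto simp: path_preimage_def)
    then obtain n' k' where q: "lasso q n' k'" "q ! 0 = x" "path_clauses x q = link p ` {..n}"
      using nearly_regular_paths_iff[OF assms(1)] by blast
    then have "link q ` {..n'} = link p ` {..n}"
      using path_clauses_lasso[OF q(1)] by simp
    then show ?thesis
      using q assms(3) by (intro lasso_unique) auto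
  qed
  ultimately show ?thesis by blast
qed

text \<open>For surjectivity the lasso is sought in \<open>idg F'\<close> instead of
  \<open>idg F\<close>: its links then form an unsatisfiable subset of \<open>F'\<close>, which by
  minimality is all of \<open>F'\<close>.\<close>

lemma path_clauses_image_eq_mus:
  assumes F: "clause_set F" and card: "\<forall>C\<in>F. card C = 1 \<or> card C = 2" and x: "{x} \<in> F"
  shows "path_clauses x ` nearly_regular_paths x (idg F) = mus {x} F"
proof (intro equalityI subsetI)
  fix F' assume "F' \<in> path_clauses x ` nearly_regular_paths x (idg F)"
  then obtain p where "p \<in> nearly_regular_paths x (idg F)" "F' = path_clauses x p" by blast
  then obtain n k where p: "lasso p n k" "p ! 0 = x" "link p ` {..n} \<subseteq> F" "F' = link p ` {..n}"
    using nearly_regular_paths_iff[OF x] path_clauses_lasso by metis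
  have "clause_set F'"
    using F p(3,4) finite_subset[of F' F] by (auto simp: clause_set_def)
  then have "minimally_unsat F'"
    using lasso.links_minimally_unsat[OF p(1)] p(4) by simp
  moreover have "{x} \<in> F'"
    using p(2) by (auto simp: p(4) link_def intro!: image_eqI[of _ _ 0])
  ultimately show "F' \<in> mus {x} F"
    using p by (simp add: mus_def)
next
  fix F' assume "F' \<in> mus {x} F"
  then have sub: "F' \<subseteq> F" and x': "{x} \<in> F'" and mu: "minimally_unsat F'"
    by (auto simp: mus_def)
  have "(x, compl x) \<in> {(a, b). {compl a, b} \<in> F'}\<^sup>*"
    using mu x' card sub by (intro minimally_unsat_reaches_compl) auto
  moreover have "\<not> regular p" if "hd p = x" "last p = compl x" "vpath p (idg F')" for p
  proof -
    have "p \<noteq> []" using that(3) by (simp add: vpath_def vwalk_def)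
    then have "x \<in> set p" "compl x \<in> set p" using that hd_in_set last_in_set by metis+
    then show ?thesis by (auto simp: regular_iff)
  qed
  ultimately have "nearly_regular_paths x (idg F') \<noteq> {}"
    using regular_or_nearly_regular_path[OF _ x'] by blast
  then obtain p n k where p: "lasso p n k" "p ! 0 = x" "link p ` {..n} \<subseteq> F'"
    using nearly_regular_paths_iff[OF x'] by blast
  then have eq: "link p ` {..n} = F'"
    using mu lasso.links_unsatisfiable minimally_unsat_subset_eq by blast
  have "p \<in> nearly_regular_paths x (idg F)"
    using nearly_regular_paths_iff[OF x] p sub by blast
  moreover have "path_clauses x p = F'"
    using path_clauses_lasso[OF p(1)] p(2) eq by simp
  ultimately show "F' \<in> path_clauses x ` nearly_regular_paths x (idg F)" by blast
qed

text \<open>The last arc ends in \<open>compl (p ! k)\<close>, so it is a unit iff it starts at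
  \<open>p ! k\<close>.\<close>

lemma (in lasso) unit_arc_iff: "unit_arc (last (vwalk_arcs p)) \<longleftrightarrow> n = Suc k"
proof -
  obtain m where m: "n = Suc m" using k_less by (cases n) auto
  then have "last (vwalk_arcs p) = (p ! m, p ! n)"
    using last_vwalk_arcs len by simp
  then have "unit_arc (last (vwalk_arcs p)) \<longleftrightarrow> p ! k = p ! m"
    unfolding unit_arc_def using final by simp
  then show ?thesis
    using nth_eq_iff[of k m] k_less m by auto
qed

text \<open>Bundles the lasso data of a path, so that the claims about it reduce to comparing
  \<open>n\<close> with \<open>Suc k\<close> and \<open>k\<close> with \<open>0\<close>.\<close>

lemma nearly_regular_pathE:
  assumes "{x} \<in> F" "P \<in> nearly_regular_paths x (idg F)"
  obtains n k where "lasso P n k" "P ! 0 = x" "link P ` {..n} \<subseteq> F"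
    "path_clauses x P = link P ` {..n}" "path_preimage F x (path_clauses x P) = {P, flip P n k}"
proof -
  obtain n k where P: "lasso P n k" "P ! 0 = x" "link P ` {..n} \<subseteq> F"
    using assms(2) unfolding nearly_regular_paths_iff[OF assms(1)] by blast
  have eq: "path_clauses x P = link P ` {..n}"
    using path_clauses_lasso[OF P(1)] by (simp only: P(2))
  then have "path_preimage F x (path_clauses x P) = {P, flip P n k}"
    using path_preimage_lasso[OF assms(1) P] by simp
  with P eq that show thesis by blast
qed

section \<open>Unit-clauses, families and preimages read off from the position of
  \<open>k\<close>\<close>

theorem theorem6p4:
  fixes F :: "'v clause set" and x :: "'v lit"
  assumes "clause_set F"
    and "\<forall>C\<in>F. card C = 1 \<or> card C = 2"
    and "{x} \<in> F"
  shows
    "((\<forall>P\<in>nearly_regular_paths x (idg F). path_clauses x P \<subseteq> F) \<and>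
     path_clauses x ` nearly_regular_paths x (idg F) = mus {x} F) \<and>
     ((\<forall>F'\<in>mus {x} F.
        (card (path_preimage F x F') = 1 \<longleftrightarrow> card (unit_clauses F') = 2) \<and>
        (card (unit_clauses F') = 2 \<longleftrightarrow> family_I F')) \<and>
     {F' \<in> mus {x} F. card (unit_clauses F') = 2} =
       path_clauses x ` {P \<in> nearly_regular_paths x (idg F). unit_arc (last (vwalk_arcs P))} \<and>
     (\<forall>P\<in>nearly_regular_paths x (idg F). unit_arc (last (vwalk_arcs P)) \<longrightarrow>
        (\<exists>y. y \<noteq> x \<and> unit_clauses (path_clauses x P) = {{x}, {y}} \<and>
             last (vwalk_arcs P) = (compl y, y) \<and>
             vpath (butlast P) (idg F) \<and> regular (butlast P) \<and>
             hd (butlast P) = x \<and> last (butlast P) = compl y))) \<and>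
     (\<forall>F'\<in>mus {x} F. card (unit_clauses F') = 1 \<longrightarrow>
       unit_clauses F' = {{x}} \<and>
       card (path_preimage F x F') = 2 \<and>
       (\<forall>P\<in>nearly_regular_paths x (idg F). path_clauses x P = F' \<longrightarrow>
          (last P = compl x \<longrightarrow>
             vwalk_length P \<ge> 2 \<and>
             family_IIa F' \<and>
             contraposition P \<noteq> P \<and>
             contraposition P \<in> nearly_regular_paths x (idg F) \<and>
             path_clauses x (contraposition P) = path_clauses x P \<and>
             path_preimage F x F' = {P, contraposition P}) \<and>
          (last P \<noteq> compl x \<longrightarrow>
             family_IIb F' \<and>
             (let P' = vwalk_join (regular_part0 P) (contraposition (regular_part1 P))
              in P' \<noteq> P \<and> path_preimage F x F' = {P, P'}))))"
proof -
  let ?U = "nearly_regular_paths x (idg F)"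
  note pathE = nearly_regular_pathE[OF assms(3)]
  have mus: "path_clauses x ` ?U = mus {x} F"
    using assms by (rule path_clauses_image_eq_mus)
  have sub: "\<forall>P\<in>?U. path_clauses x P \<subseteq> F"
    by (auto elim!: pathE)
  have mu2: "minimally_unsat_2cnf F'" if "F' \<in> mus {x} F" for F'
    using that assms(2) by (fastforce simp: mus_def minimally_unsat_2cnf_def)
  have preimage: "(card (path_preimage F x F') = 1 \<longleftrightarrow> card (unit_clauses F') = 2) \<and>
      (card (unit_clauses F') = 1 \<longrightarrow>
        unit_clauses F' = {{x}} \<and> card (path_preimage F x F') = 2)"
    if F': "F' \<in> mus {x} F" for F'
  proof -
    obtain P where P: "P \<in> ?U" "path_clauses x P = F'"
      using F' unfolding mus[symmetric] by blast
    obtain n k where l: "lasso P n k" and facts: "P ! 0 = x" "link P ` {..n} \<subseteq> F"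
        "path_clauses x P = link P ` {..n}" "path_preimage F x (path_clauses x P) = {P, flip P n k}"
      by (rule pathE[OF P(1)])
    note * = facts(1) facts(3,4)[unfolded P(2)]
    interpret lasso P n k by fact
    have units: "unit_clauses F' = (if n = Suc k then {{x}, {P ! n}} else {{x}})"
      unfolding *(2) unit_clauses_links *(1) by (rule refl)
    have card_units: "card (unit_clauses F') = (if n = Suc k then 2 else 1)"
      unfolding *(2) by (rule card_unit_clauses_links)
    have "card (path_preimage F x F') = (if n = Suc k then 1 else 2)"
    proof (cases "n = Suc k")
      case True
      then show ?thesis unfolding *(3) flip_eq_self[OF True] by simp
    next
      case False
      then have "flip P n k \<noteq> P" using flip_neq k_less by simp
      then show ?thesis unfolding *(3) using False by simp
    qed
    with units card_units show ?thesis by (simp split: if_splits)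
  qed
  have two_units: "unit_arc (last (vwalk_arcs P)) \<longleftrightarrow> card (unit_clauses (path_clauses x P)) = 2"
    if P: "P \<in> ?U" for P
  proof -
    obtain n k where l: "lasso P n k" and *: "P ! 0 = x" "link P ` {..n} \<subseteq> F"
        "path_clauses x P = link P ` {..n}" "path_preimage F x (path_clauses x P) = {P, flip P n k}"
      by (rule pathE[OF P])
    interpret lasso P n k by fact
    show ?thesis
      unfolding *(3) card_unit_clauses_links unit_arc_iff by simp
  qed
  have unit_end: "\<exists>y. y \<noteq> x \<and> unit_clauses (path_clauses x P) = {{x}, {y}} \<and>
      last (vwalk_arcs P) = (compl y, y) \<and>
      vpath (butlast P) (idg F) \<and> regular (butlast P) \<and>
      hd (butlast P) = x \<and> last (butlast P) = compl y"
    if P: "P \<in> ?U" and unit: "unit_arc (last (vwalk_arcs P))" for P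
  proof -
    obtain n k where l: "lasso P n k" and *: "P ! 0 = x" "link P ` {..n} \<subseteq> F"
        "path_clauses x P = link P ` {..n}" "path_preimage F x (path_clauses x P) = {P, flip P n k}"
      by (rule pathE[OF P])
    interpret lasso P n k by fact
    have n: "n = Suc k" using unit by (simp only: unit_arc_iff)
    obtain q w where q: "P = q @ [w]" "length q = n"
      using len by (metis length_Suc_conv_rev)
    have q_ne: "q \<noteq> []" using q n by auto
    have w: "P ! n = w" using q by auto
    have "q ! k = compl w"
      using final q n by (auto simp: nth_append w)
    then have last_q: "last q = compl w"
      using q n q_ne by (simp add: last_conv_nth)
    have path: "vpath P (idg F)" and reg: "regular q"
      using P q by (auto simp: nearly_regular_paths_def nearly_regular_def)
    have units: "unit_clauses (path_clauses x P) = {{x}, {w}}"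
      unfolding *(3) unit_clauses_links *(1) w using n by simp
    have "vpath q (idg F)"
      using path q_ne vwalkI_append_l[of q "[w]" "idg F"] by (auto simp: vpath_def q)
    moreover have "hd q = x"
      using P q_ne by (auto simp: nearly_regular_paths_def q)
    \<comment> \<open>The vertices of \<open>P\<close> are distinct, and \<open>x\<close> already
      occurs in \<open>q\<close>.\<close>
    moreover have "w \<noteq> x"
      using path q_ne \<open>hd q = x\<close> hd_in_set[OF q_ne] by (auto simp: vpath_def q)
    moreover have "last (vwalk_arcs P) = (compl w, w)"
      using q_ne last_q by (simp add: q vwalk_arcs_append)
    ultimately show ?thesis
      using reg last_q units by (intro exI[of _ w]) (simp add: q)
  qed
  have one_unit: "(last P = compl x \<longrightarrow>
        vwalk_length P \<ge> 2 \<and> family_IIa F' \<and> contraposition P \<noteq> P \<and>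
        contraposition P \<in> ?U \<and> path_clauses x (contraposition P) = path_clauses x P \<and>
        path_preimage F x F' = {P, contraposition P}) \<and>
      (last P \<noteq> compl x \<longrightarrow>
        family_IIb F' \<and>
        (let P' = vwalk_join (regular_part0 P) (contraposition (regular_part1 P))
         in P' \<noteq> P \<and> path_preimage F x F' = {P, P'}))"
    if F': "F' \<in> mus {x} F" and one: "card (unit_clauses F') = 1"
      and P: "P \<in> ?U" "path_clauses x P = F'" for F' P
  proof -
    obtain n k where l: "lasso P n k" and facts: "P ! 0 = x" "link P ` {..n} \<subseteq> F"
        "path_clauses x P = link P ` {..n}" "path_preimage F x (path_clauses x P) = {P, flip P n k}"
      by (rule pathE[OF P(1)])
    note * = facts(1) facts(3,4)[unfolded P(2)]
    interpret lasso P n k by fact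
    \<comment> \<open>A loop of length 1 would produce a second unit-clause.\<close>
    have k: "Suc k < n"
      using one k_less unfolding *(2) card_unit_clauses_links by (simp split: if_splits)
    have II: "family_II F'" "unit_clauses F' = {{x}}"
      using preimage[OF F'] mu2[OF F'] one by (auto simp: family_II_def)
    have deg: "{v. vdeg F' v = 3} = {var (P ! k)}"
      unfolding *(2) by (rule vdeg_eq_3[OF k])
    have last: "last P = compl x \<longleftrightarrow> k = 0"
      using k_less nth_eq_iff[of k 0] *(1) by (auto simp: last_eq)
    have "flip P n k \<in> path_preimage F x F'" using *(3) by simp
    then have flip: "flip P n k \<in> ?U" "path_clauses x (flip P n k) = F'"
      by (auto simp: path_preimage_def)
    show ?thesis
    proof (cases "k = 0")
      case True
      then have contra: "contraposition P = flip P n k"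
        by (intro flip_eq_contraposition[symmetric])
      have "family_IIa F'"
        using II deg True *(1) by (auto simp: family_IIa_def)
      then show ?thesis
        using True last k len flip P(2) *(3) flip_neq[OF k] unfolding contra by simp
    next
      case False
      \<comment> \<open>A nontrivial stem separates the degree-3 variable from that of the
        unit-clause, which distinguishes Family IIb from Family IIa.\<close>
      have "var (P ! k) \<noteq> var x"
        using False k_less *(1) inj[of k 0] by auto
      then have "family_IIb F'"
        using II deg by (auto simp: family_IIb_def)
      then show ?thesis
        using False last *(3) flip_neq[OF k] unfolding flip_eq_join[symmetric] Let_def by simp
    qed
  qed
  have two_units_set: "{F' \<in> mus {x} F. card (unit_clauses F') = 2} =
      path_clauses x ` {P \<in> ?U. unit_arc (last (vwalk_arcs P))}"
    using two_units by (auto simp: mus[symmetric])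
  have family_I: "card (unit_clauses F') = 2 \<longleftrightarrow> family_I F'" if "F' \<in> mus {x} F" for F'
    using mu2[OF that] by (simp add: family_I_def)
  show ?thesis
  proof (intro conjI, goal_cases)
    case 3
    show ?case by (intro ballI conjI preimage[THEN conjunct1] family_I)
  next
    case 5
    show ?case by (intro ballI impI unit_end)
  next
    case 6
    show ?case
      by (intro ballI impI, rule conjI, use preimage in blast, rule conjI, use preimage in blast,
          intro ballI impI, rule one_unit)
  qed (fact sub mus two_units_set)+
qed

end
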